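(* Let $k$ be a positive integer and $n=2k$. Then $rn(C_n\square C_n)\ge \frac{n^2-2}{2}(k+2)+2$.
   Context: $C_n$ is the cycle graph with vertex set $\{0,\dots,n-1\}$, $v,w$ adjacent iff $v\equiv w\pm1 \pmod n$. The Cartesian product $G\square H$ has vertex set $V(G)\times V(H)$, with $(g,h)\sim(g',h')$ iff ($g=g'$ and $hh'\in E(H)$) or ($h=h'$ and $gg'\in E(G)$). $d(u,v)$ is graph distance and $\operatorname{diam}(G)$ the maximum distance in $G$. A radio labeling of a connected graph $G$ is a function $c:V(G)\to\{1,2,\dots\}$ with $d(u,v)+|c(u)-c(v)|\ge 1+\operatorname{diam}(G)$ for all distinct $u,v$. The span of $c$ is its maximum value; the radio number $rn(G)$ is the minimum span over all radio labelings of $G$. *)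

theory Defs
  imports Complex_Main "HOL-Number_Theory.Cong" "Graph_Theory.Graph_Theory"
begin

text \<open>
  As in the AFP entry Graph_Theory, a graph is a symmetric digraph without parallel arcs: each
  undirected edge \<open>uv\<close> is represented by the two arcs \<open>(u, v)\<close> and \<open>(v, u)\<close>.
\<close>

definition cycle_graph :: "nat \<Rightarrow> nat pair_pre_digraph" where
  "cycle_graph n = \<lparr> pverts = {0..<n},
     parcs = {(v, w). v < n \<and> w < n \<and>
       ([int v = int w + 1] (mod (int n)) \<or> [int v = int w - 1] (mod (int n)))} \<rparr>"

definition cartesian_product ::
  "'a pair_pre_digraph \<Rightarrow> 'b pair_pre_digraph \<Rightarrow> ('a \<times> 'b) pair_pre_digraph" where
  "cartesian_product G H = \<lparr> pverts = pverts G \<times> pverts H,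
     parcs = {((g, h), (g', h')).
       g = g' \<and> g \<in> pverts G \<and> (h, h') \<in> parcs H \<or>
       h = h' \<and> h \<in> pverts H \<and> (g, g') \<in> parcs G} \<rparr>"

text \<open>
  The following notions are meaningful for finite nonempty connected graphs.  The lemma
  \<open>graph_dist_eq_mu\<close> below relates \<open>graph_dist\<close> to the library's extended-real weighted distance.
\<close>

definition graph_dist :: "'a pair_pre_digraph \<Rightarrow> 'a \<Rightarrow> 'a \<Rightarrow> nat" where
  "graph_dist G u v = (LEAST l. \<exists>p. pre_digraph.awalk (with_proj G) u p v \<and> length p = l)"

definition graph_diam :: "'a pair_pre_digraph \<Rightarrow> nat" where
  "graph_diam G = Max {graph_dist G u v | u v. u \<in> pverts G \<and> v \<in> pverts G}"

definition radio_labeling :: "'a pair_pre_digraph \<Rightarrow> ('a \<Rightarrow> nat) \<Rightarrow> bool" where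
  "radio_labeling G c \<longleftrightarrow>
     (\<forall>u \<in> pverts G. c u \<ge> 1) \<and>
     (\<forall>u \<in> pverts G. \<forall>v \<in> pverts G. u \<noteq> v \<longrightarrow>
        int (graph_dist G u v) + \<bar>int (c u) - int (c v)\<bar> \<ge> 1 + int (graph_diam G))"

definition labeling_span :: "'a pair_pre_digraph \<Rightarrow> ('a \<Rightarrow> nat) \<Rightarrow> nat" where
  "labeling_span G c = Max (c ` pverts G)"

definition radio_number :: "'a pair_pre_digraph \<Rightarrow> nat" where
  "radio_number G = (LEAST s. \<exists>c. radio_labeling G c \<and> labeling_span G c = s)"

lemma (in pair_wf_digraph) graph_dist_eq_mu:
  assumes "u \<rightarrow>\<^sup>*\<^bsub>with_proj G\<^esub> v"
  shows "\<mu> (\<lambda>_. 1) u v = ereal (real (graph_dist G u v))"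
proof -
  have cost: "awalk_cost (\<lambda>_. 1) p = real (length p)" for p
    by (induction p) auto
  obtain p where "awalk u p v" using assms by (auto simp: reachable_awalk)
  then have "\<exists>l p. awalk u p v \<and> length p = l" by blast
  then have "\<exists>p. awalk u p v \<and> length p = graph_dist G u v"
    unfolding graph_dist_def by (rule LeastI_ex)
  then obtain q where q: "awalk u q v" "length q = graph_dist G u v" by blast
  have le: "graph_dist G u v \<le> length p" if "awalk u p v" for p
    unfolding graph_dist_def using that by (intro Least_le) blast
  show ?thesis unfolding \<mu>_def cost
  proof (rule antisym)
    show "(INF p\<in>{p. awalk u p v}. ereal (real (length p))) \<le> ereal (real (graph_dist G u v))"
      by (rule INF_lower2[of q]) (use q in auto)
    show "ereal (real (graph_dist G u v)) \<le> (INF p\<in>{p. awalk u p v}. ereal (real (length p)))"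
      by (rule INF_greatest) (use le in auto)
  qed
qed

lemma pair_graph_cycle_graph:
  assumes "n \<ge> 2"
  shows "pair_graph (cycle_graph n)"
proof
  show "fst e \<in> pverts (cycle_graph n)" "snd e \<in> pverts (cycle_graph n)"
    if "e \<in> parcs (cycle_graph n)" for e
    using that by (auto simp: cycle_graph_def)
  show "finite (pverts (cycle_graph n))"
    by (auto simp: cycle_graph_def)
  show "finite (parcs (cycle_graph n))"
    by (rule finite_subset[of _ "{0..<n} \<times> {0..<n}"]) (auto simp: cycle_graph_def)
  show "fst e \<noteq> snd e" if e: "e \<in> parcs (cycle_graph n)" for e
  proof
    assume "fst e = snd e"
    with e have "int n dvd 1"
      by (auto simp: cycle_graph_def cong_iff_dvd_diff)
    with assms show False by simp
  qed
  have "[int w = int v + 1] (mod (int n)) \<longleftrightarrow> [int v = int w - 1] (mod (int n))" for v w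
    by (simp add: cong_iff_dvd_diff dvd_diff_commute algebra_simps)
  then show "symmetric (with_proj (cycle_graph n))"
    by (auto simp: symmetric_def sym_def cycle_graph_def)
qed

lemma pair_graph_cartesian_product:
  assumes "pair_graph G" "pair_graph H"
  shows "pair_graph (cartesian_product G H)"
proof -
  interpret G: pair_graph G by fact
  interpret H: pair_graph H by fact
  have s: "(v, u) \<in> parcs G" if "(u, v) \<in> parcs G" for u v
    using that G.pair_sym_arcs by (auto simp: symmetric_def sym_def)
  have s': "(v, u) \<in> parcs H" if "(u, v) \<in> parcs H" for u v
    using that H.pair_sym_arcs by (auto simp: symmetric_def sym_def)
  show ?thesis
  proof
    show "fst e \<in> pverts (cartesian_product G H)" "snd e \<in> pverts (cartesian_product G H)"
      if "e \<in> parcs (cartesian_product G H)" for e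
      using that by (auto simp: cartesian_product_def dest: G.wellformed' H.wellformed')
    show "finite (pverts (cartesian_product G H))"
      by (simp add: cartesian_product_def G.pair_finite_verts H.pair_finite_verts)
    show "finite (parcs (cartesian_product G H))"
      by (rule finite_subset[of _ "(pverts G \<times> pverts H) \<times> (pverts G \<times> pverts H)"])
        (auto simp: cartesian_product_def G.pair_finite_verts H.pair_finite_verts
          dest: G.wellformed' H.wellformed')
    show "fst e \<noteq> snd e" if "e \<in> parcs (cartesian_product G H)" for e
      using that by (auto simp: cartesian_product_def dest: G.pair_no_loops H.pair_no_loops)
    show "symmetric (with_proj (cartesian_product G H))"
      by (auto simp: symmetric_def sym_def cartesian_product_def intro: s s')
  qed
qed

end

theory Submission
  imports Defs
begin

text \<open>
  Around a triple of vertices the distances in each cyclic coordinate sum to at most \<open>n\<close>, so three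
  vertices are pairwise at total distance at most \<open>2n = 4k\<close>, while the diameter is \<open>n = 2k\<close>.
  Adding the three radio conditions for vertices with labels \<open>c u \<le> c v \<le> c w\<close> gives
  \<open>2 (c w - c u) \<ge> 3 (2k + 1) - 4k\<close>, that is \<open>c w - c u \<ge> k + 2\<close>.  Hence every two further vertices
  in the order of labels raise the span by \<open>k + 2\<close>, starting from the labels \<open>1\<close> and \<open>2\<close>.
\<close>

section \<open>Walks as powers of the arc relation\<close>

context pair_wf_digraph
begin

lemma awalk_imp_relpow: "awalk u p v \<Longrightarrow> (u, v) \<in> parcs G ^^ length p"
  by (induction p arbitrary: u) (auto simp: awalk_Cons_iff awalk_Nil_iff simp del: relpow.simps(2) intro: relpow_Suc_I2)

text \<open>The empty walk exists only at a vertex, hence the assumption on \<open>u\<close>; the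
  later vertices of the walk are vertices by well-formedness.\<close>

lemma relpow_imp_awalk:
  "u \<in> pverts G \<Longrightarrow> (u, v) \<in> parcs G ^^ l \<Longrightarrow> \<exists>p. awalk u p v \<and> length p = l"
proof (induction l arbitrary: u)
  case 0
  then show ?case by (auto simp: awalk_Nil_iff)
next
  case (Suc l)
  from Suc.prems(2) obtain w where w: "(u, w) \<in> parcs G" "(w, v) \<in> parcs G ^^ l"
    by (meson relpow_Suc_D2)
  with Suc.IH[of w] obtain p where "awalk w p v" "length p = l"
    by (auto dest: wellformed')
  with w(1) show ?case
    by (intro exI[of _ "(u, w) # p"]) (auto simp: awalk_Cons_iff)
qed

lemma graph_dist_le: "u \<in> pverts G \<Longrightarrow> (u, v) \<in> parcs G ^^ l \<Longrightarrow> graph_dist G u v \<le> l"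
  unfolding graph_dist_def by (rule Least_le) (rule relpow_imp_awalk)

text \<open>Reachability makes the set under \<open>LEAST\<close> nonempty, so the minimum is
  attained by an actual walk.\<close>

lemma relpow_graph_dist:
  assumes "u \<in> pverts G" "(u, v) \<in> (parcs G)\<^sup>*"
  shows "(u, v) \<in> parcs G ^^ graph_dist G u v"
proof -
  obtain l where "(u, v) \<in> parcs G ^^ l"
    using assms(2) rtrancl_imp_relpow by blast
  then have "\<exists>l p. awalk u p v \<and> length p = l"
    using relpow_imp_awalk assms(1) by blast
  then have "\<exists>p. awalk u p v \<and> length p = graph_dist G u v"
    unfolding graph_dist_def by (rule LeastI_ex)
  then show ?thesis
    using awalk_imp_relpow by metis
qed

end

text \<open>A potential that rises by at most one along each arc bounds walk lengths from below;
  this serves to bound the diameter from below.\<close>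

lemma relpow_lipschitz:
  fixes f :: "'a \<Rightarrow> nat"
  assumes "\<And>x y. (x, y) \<in> R \<Longrightarrow> f y \<le> Suc (f x)" and "(u, v) \<in> R ^^ l"
  shows "f v \<le> f u + l"
  using assms(2)
proof (induction l arbitrary: v)
  case (Suc l)
  then obtain w where "(u, w) \<in> R ^^ l" "(w, v) \<in> R" by auto
  with Suc.IH assms(1) show ?case by fastforce
qed auto

text \<open>Walk first in the copy of \<open>G\<close> at \<open>h\<close>, then in the copy of
  \<open>H\<close> at \<open>g'\<close>; the two membership assumptions place these copies inside
  the product.\<close>

lemma relpow_cartesian_product:
  assumes g: "(g, g') \<in> parcs G ^^ l" and h: "(h, h') \<in> parcs H ^^ m"
    and "h \<in> pverts H" "g' \<in> pverts G"
  shows "((g, h), (g', h')) \<in> parcs (cartesian_product G H) ^^ (l + m)"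
proof -
  let ?R = "parcs (cartesian_product G H)"
  have "((g, h), (g', h)) \<in> ?R ^^ l"
    using g
  proof (induction l arbitrary: g')
    case (Suc l)
    then show ?case
      using assms(3) by (auto simp: cartesian_product_def)
  qed auto
  moreover have "((g', h), (g', h')) \<in> ?R ^^ m"
    using h
  proof (induction m arbitrary: h')
    case (Suc m)
    then show ?case
      using assms(4) by (auto simp: cartesian_product_def)
  qed auto
  ultimately show ?thesis
    by (auto simp: relpow_add)
qed

section \<open>Distances in the cycle\<close>

definition cyc_dist :: "nat \<Rightarrow> nat \<Rightarrow> nat \<Rightarrow> nat" where
  "cyc_dist n a b = nat (min \<bar>int a - int b\<bar> (int n - \<bar>int a - int b\<bar>))"

text \<open>Three points cut the cycle into three arcs of total length \<open>n\<close>, and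
  \<open>cyc_dist\<close>, the length of a shorter arc, is for each pair at most the arc between
  them that avoids the third point.\<close>

lemma cyc_dist_triangle_perimeter:
  assumes "a < n" "b < n" "c < n"
  shows "cyc_dist n a b + cyc_dist n b c + cyc_dist n a c \<le> n"
  using assms unfolding cyc_dist_def by linarith

lemma sym_cycle_graph: "sym (parcs (cycle_graph n))"
proof (rule symI)
  have "[int w = int v + 1] (mod (int n)) \<longleftrightarrow> [int v = int w - 1] (mod (int n))" for v w
    by (simp add: cong_iff_dvd_diff dvd_diff_commute algebra_simps)
  then show "(v, u) \<in> parcs (cycle_graph n)" if "(u, v) \<in> parcs (cycle_graph n)" for u v
    using that by (auto simp: cycle_graph_def)
qed

lemma sym_relpow: "sym R \<Longrightarrow> sym (R ^^ l)"
proof (induction l)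
  case (Suc l)
  then show ?case
    by (meson relpow_Suc_E relpow_Suc_I2 symD symI)
qed (auto simp: sym_def)

lemma relpow_cycle_graph_add:
  "a + j < n \<Longrightarrow> (a, a + j) \<in> parcs (cycle_graph n) ^^ j"
proof (induction j)
  case (Suc j)
  then have "(a + j, a + Suc j) \<in> parcs (cycle_graph n)"
    by (auto simp: cycle_graph_def cong_iff_dvd_diff)
  with Suc show ?case by auto
qed auto

text \<open>Two routes compete: ascend directly from \<open>a\<close> to \<open>b\<close>, or
  descend to 0, cross to \<open>n - 1\<close> and descend to \<open>b\<close>.\<close>

lemma relpow_cycle_graph_le:
  assumes "a \<le> b" "b < n"
  shows "(a, b) \<in> parcs (cycle_graph n) ^^ cyc_dist n a b"
proof (cases "cyc_dist n a b = b - a")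
  case True
  then show ?thesis
    using relpow_cycle_graph_add[of a "b - a" n] assms by simp
next
  case False
  let ?R = "parcs (cycle_graph n)"
  have "(a, 0) \<in> ?R ^^ a"
    using relpow_cycle_graph_add[of 0 a n] sym_relpow[OF sym_cycle_graph] assms
    by (auto dest: symD)
  \<comment> \<open>The wrap-around arc: 0 is congruent to \<open>(n - 1) + 1\<close>.\<close>
  moreover have "(0, n - 1) \<in> ?R"
    using assms by (auto simp: cycle_graph_def cong_iff_dvd_diff of_nat_diff)
  moreover have "(n - 1, b) \<in> ?R ^^ (n - 1 - b)"
    using relpow_cycle_graph_add[of b "n - 1 - b" n] sym_relpow[OF sym_cycle_graph] assms
    by (auto dest: symD)
  ultimately have "(a, b) \<in> ?R ^^ (Suc a + (n - 1 - b))"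
    unfolding relpow_add by auto
  \<comment> \<open>Here \<open>cyc_dist n a b\<close> is \<open>n - (b - a)\<close>; the
    \<open>Suc\<close> counts the wrap-around arc.\<close>
  moreover have "Suc a + (n - 1 - b) = cyc_dist n a b"
    using False assms unfolding cyc_dist_def by linarith
  ultimately show ?thesis by metis
qed

lemma relpow_cycle_graph:
  assumes "a < n" "b < n"
  shows "(a, b) \<in> parcs (cycle_graph n) ^^ cyc_dist n a b"
proof (cases "a \<le> b")
  case True
  then show ?thesis using relpow_cycle_graph_le assms by simp
next
  case False
  then have "(b, a) \<in> parcs (cycle_graph n) ^^ cyc_dist n b a"
    using relpow_cycle_graph_le assms by simp
  moreover have "cyc_dist n b a = cyc_dist n a b"
    by (simp add: cyc_dist_def abs_minus_commute)
  ultimately show ?thesis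
    using sym_relpow[OF sym_cycle_graph] by (auto dest: symD)
qed

text \<open>Makes the distance from 0 a potential for \<open>relpow_lipschitz\<close>. An arc is a
  unit step or joins 0 and \<open>n - 1\<close>, and either changes that distance by at most
  one.\<close>

lemma cyc_dist_lipschitz:
  assumes "(a, b) \<in> parcs (cycle_graph n)"
  shows "cyc_dist n 0 b \<le> Suc (cyc_dist n 0 a)"
proof -
  have ab: "a < n" "b < n" and "int n dvd int a - int b - 1 \<or> int n dvd int a - int b + 1"
    using assms by (auto simp: cycle_graph_def cong_iff_dvd_diff algebra_simps)
  then obtain q where q: "int a - int b - 1 = int n * q \<or> int a - int b + 1 = int n * q"
    by (auto elim!: dvdE)
  \<comment> \<open>Since \<open>a\<close> and \<open>b\<close> lie below \<open>n\<close>, they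
    differ by at most \<open>n - 1\<close>, and the shift by 1 adds at most 1.\<close>
  have "\<bar>int n * q\<bar> \<le> int n * 1"
    using q ab by linarith
  then have "\<bar>q\<bar> \<le> 1"
    using ab by (simp add: abs_mult)
  then consider "q = -1" | "q = 0" | "q = 1"
    by linarith
  then show ?thesis
    using q ab unfolding cyc_dist_def by cases (simp_all, linarith+)
qed

section \<open>Distances and diameter of the torus\<close>

lemma pair_graph_torus:
  "n \<ge> 2 \<Longrightarrow> pair_graph (cartesian_product (cycle_graph n) (cycle_graph n))"
  by (intro pair_graph_cartesian_product pair_graph_cycle_graph)

lemma pverts_torus [simp]:
  "pverts (cartesian_product (cycle_graph n) (cycle_graph n)) = {0..<n} \<times> {0..<n}"
  by (simp add: cartesian_product_def cycle_graph_def)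

lemma relpow_torus:
  assumes "a < n" "b < n" "a' < n" "b' < n"
  shows "((a, b), (a', b')) \<in> parcs (cartesian_product (cycle_graph n) (cycle_graph n)) ^^
    (cyc_dist n a a' + cyc_dist n b b')"
  using assms by (intro relpow_cartesian_product relpow_cycle_graph) (auto simp: cycle_graph_def)

lemma graph_dist_torus_le:
  assumes "n \<ge> 2" "a < n" "b < n" "a' < n" "b' < n"
  shows "graph_dist (cartesian_product (cycle_graph n) (cycle_graph n)) (a, b) (a', b')
    \<le> cyc_dist n a a' + cyc_dist n b b'"
proof -
  interpret pair_graph "cartesian_product (cycle_graph n) (cycle_graph n)"
    by (rule pair_graph_torus) fact
  show ?thesis
    using assms by (intro graph_dist_le relpow_torus) auto
qed

lemma graph_dist_torus_perimeter:
  assumes "n \<ge> 2" "{u, v, w} \<subseteq> {0..<n} \<times> {0..<n}"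
  defines "T \<equiv> cartesian_product (cycle_graph n) (cycle_graph n)"
  shows "graph_dist T u v + graph_dist T v w + graph_dist T u w \<le> 2 * n"
proof -
  obtain a b a' b' a'' b'' where "u = (a, b)" "v = (a', b')" "w = (a'', b'')"
    by (metis surj_pair)
  then show ?thesis
    using assms(2) graph_dist_torus_le[OF assms(1), of a b a' b']
      graph_dist_torus_le[OF assms(1), of a' b' a'' b'']
      graph_dist_torus_le[OF assms(1), of a b a'' b'']
      cyc_dist_triangle_perimeter[of a n a' a''] cyc_dist_triangle_perimeter[of b n b' b'']
    unfolding T_def by simp
qed

lemma graph_dist_le_diam:
  assumes "finite (pverts G)" "u \<in> pverts G" "v \<in> pverts G"
  shows "graph_dist G u v \<le> graph_diam G"
proof -
  have "{graph_dist G u v | u v. u \<in> pverts G \<and> v \<in> pverts G}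
      = (\<lambda>(u, v). graph_dist G u v) ` (pverts G \<times> pverts G)"
    by auto
  then show ?thesis
    unfolding graph_diam_def using assms by (intro Max_ge) auto
qed

text \<open>The antipodal vertices (0, 0) and (k, k) are at distance at least \<open>n\<close>: the
  sum of the cyclic distances from 0 rises by at most one per arc, as an arc changes only one
  coordinate.\<close>

lemma graph_diam_torus_ge:
  assumes "k > 0" "n = 2 * k"
  shows "n \<le> graph_diam (cartesian_product (cycle_graph n) (cycle_graph n))"
proof -
  let ?T = "cartesian_product (cycle_graph n) (cycle_graph n)"
  have n: "n \<ge> 2" "k < n" using assms by auto
  interpret pair_graph ?T
    by (rule pair_graph_torus) (rule n)
  let ?f = "\<lambda>(a, b). cyc_dist n 0 a + cyc_dist n 0 b"
  have "?f y \<le> Suc (?f x)" if "(x, y) \<in> parcs ?T" for x y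
    using that cyc_dist_lipschitz[of _ _ n] by (auto simp: cartesian_product_def)
  moreover have "((0, 0), (k, k)) \<in> parcs ?T ^^ graph_dist ?T (0, 0) (k, k)"
    using relpow_torus[of 0 n 0 k k] n by (intro relpow_graph_dist relpow_imp_rtrancl) auto
  ultimately have "?f (k, k) \<le> ?f (0, 0) + graph_dist ?T (0, 0) (k, k)"
    by (rule relpow_lipschitz)
  \<comment> \<open>As \<open>n = 2 * k\<close>, the point \<open>k\<close> is opposite to 0 and
    each coordinate contributes \<open>k\<close>.\<close>
  moreover have "?f (k, k) = n" "?f (0, 0) = 0"
    using assms by (auto simp: cyc_dist_def)
  moreover have "graph_dist ?T (0, 0) (k, k) \<le> graph_diam ?T"
    using n by (intro graph_dist_le_diam) auto
  ultimately show ?thesis by simp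
qed

section \<open>Radio labelings and the growth of labels\<close>

lemma ex_radio_labeling:
  assumes "finite (pverts G)"
  shows "\<exists>c. radio_labeling G c"
proof -
  obtain f :: "'a \<Rightarrow> nat" where f: "inj_on f (pverts G)"
    using finite_imp_inj_to_nat_seg[OF assms] by blast
  \<comment> \<open>Scaling an injective numbering by \<open>D\<close> separates the labels enough
    for the radio condition at any distance; the offset 1 makes them positive.\<close>
  define D where "D = 1 + graph_diam G"
  have "int D \<le> \<bar>int (1 + f u * D) - int (1 + f v * D)\<bar>"
    if "u \<in> pverts G" "v \<in> pverts G" "u \<noteq> v" for u v
  proof -
    have "f u \<noteq> f v"
      using f that by (auto simp: inj_on_def)
    then have "1 \<le> \<bar>int (f u) - int (f v)\<bar>"
      by linarith
    then have "1 * int D \<le> \<bar>int (f u) - int (f v)\<bar> * int D"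
      by (rule mult_right_mono) simp
    also have "\<dots> = \<bar>(int (f u) - int (f v)) * int D\<bar>"
      by (simp add: abs_mult)
    also have "(int (f u) - int (f v)) * int D = int (1 + f u * D) - int (1 + f v * D)"
      by (simp add: algebra_simps)
    finally show ?thesis by simp
  qed
  then have "radio_labeling G (\<lambda>u. 1 + f u * D)"
    unfolding radio_labeling_def D_def by fastforce
  then show ?thesis by blast
qed

lemma radio_number_attained:
  assumes "finite (pverts G)"
  obtains c where "radio_labeling G c" "labeling_span G c = radio_number G"
proof -
  have "\<exists>s c. radio_labeling G c \<and> labeling_span G c = s"
    using ex_radio_labeling[OF assms] by blast
  then have "\<exists>c. radio_labeling G c \<and> labeling_span G c = radio_number G"
    unfolding radio_number_def by (rule LeastI_ex)
  then show ?thesis using that by blast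
qed

text \<open>Induction on \<open>m\<close>, removing the two largest labels: the largest exceeds
  every label left by at least \<open>g\<close>.\<close>

lemma label_growth:
  fixes c :: "'a \<Rightarrow> nat"
  assumes "card A = 2 * m + 2" "inj_on c A" "\<And>u. u \<in> A \<Longrightarrow> c u \<ge> 1"
    and "\<And>u v w. \<lbrakk>{u, v, w} \<subseteq> A; u \<noteq> v; v \<noteq> w; u \<noteq> w; c u \<le> c v; c v \<le> c w\<rbrakk> \<Longrightarrow> c u + g \<le> c w"
  shows "\<exists>v\<in>A. m * g + 2 \<le> c v"
  using assms
proof (induction m arbitrary: A)
  case 0
  have "card A = 2" using "0.prems"(1) by simp
  then obtain u v where "A = {u, v}" "u \<noteq> v"
    unfolding card_2_iff by blast
  \<comment> \<open>Two distinct positive labels cannot both be 1, which gives the summand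
    2.\<close>
  moreover have "c u \<noteq> c v" "c u \<ge> 1" "c v \<ge> 1"
    using "0.prems"(2,3) calculation by (auto simp: inj_on_def)
  ultimately show ?case by auto
next
  case (Suc m)
  have fin: "finite A"
    using Suc.prems(1) by (intro card_ge_0_finite) simp
  have ex_max: "\<exists>w\<in>B. \<forall>u\<in>B. c u \<le> c w" if "finite B" "B \<noteq> {}" for B
  proof -
    have "Max (c ` B) \<in> c ` B"
      using that by simp
    then obtain w where "w \<in> B" "c w = Max (c ` B)" by auto
    with that show ?thesis
      by (intro bexI[of _ w]) auto
  qed
  have "A \<noteq> {}" using Suc.prems(1) by auto
  then obtain w where w: "w \<in> A" "\<forall>u\<in>A. c u \<le> c w"
    using ex_max fin by blast
  have card1: "card (A - {w}) = 2 * m + 3"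
    using Suc.prems(1) w fin by simp
  then have "A - {w} \<noteq> {}" by (intro notI) simp
  then obtain v where v: "v \<in> A - {w}" "\<forall>u\<in>A - {w}. c u \<le> c v"
    using ex_max fin by (metis finite_Diff)
  let ?B = "A - {w} - {v}"
  have "\<exists>u\<in>?B. m * g + 2 \<le> c u"
  proof (rule Suc.IH)
    show "card ?B = 2 * m + 2"
      using card1 v fin by simp
    show "inj_on c ?B"
      using Suc.prems(2) by (rule inj_on_subset) auto
    show "c u \<ge> 1" if "u \<in> ?B" for u
      using that Suc.prems(3) by auto
    show "c x + g \<le> c z"
      if "{x, y, z} \<subseteq> ?B" "x \<noteq> y" "y \<noteq> z" "x \<noteq> z" "c x \<le> c y" "c y \<le> c z" for x y z
      by (rule Suc.prems(4)[of x y z]) (use that in auto)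
  qed
  then obtain u where u: "u \<in> ?B" "m * g + 2 \<le> c u" by blast
  \<comment> \<open>By the choice of \<open>w\<close> and \<open>v\<close> the triple
    \<open>u\<close>, \<open>v\<close>, \<open>w\<close> is sorted by label.\<close>
  have "c u + g \<le> c w"
    by (rule Suc.prems(4)[of u v w]) (use u v w in auto)
  with u w(1) show ?case by (intro bexI[of _ w]) auto
qed

theorem theorem2p3:
  fixes k n :: nat
  assumes "k > 0" and "n = 2 * k"
  shows "real (radio_number (cartesian_product (cycle_graph n) (cycle_graph n)))
    \<ge> ((real n)\<^sup>2 - 2) / 2 * (real k + 2) + 2"
proof -
  let ?T = "cartesian_product (cycle_graph n) (cycle_graph n)"
  let ?V = "{0..<n} \<times> {0..<n}"
  have n: "n \<ge> 2" using assms by simp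
  obtain c where c: "radio_labeling ?T c" and span: "labeling_span ?T c = radio_number ?T"
    by (rule radio_number_attained[of ?T]) auto
  have radio: "int (graph_dist ?T u v) + \<bar>int (c u) - int (c v)\<bar> \<ge> 1 + int (graph_diam ?T)"
    if "u \<in> ?V" "v \<in> ?V" "u \<noteq> v" for u v
    using c that unfolding radio_labeling_def pverts_torus by blast
  \<comment> \<open>Chosen so that the \<open>n\<close> squared, that is
    \<open>4 * k\<^sup>2\<close>, vertices number \<open>2 * m + 2\<close>; the subtraction is exact
    because \<open>k > 0\<close>.\<close>
  define m where "m = 2 * k\<^sup>2 - 1"
  have m: "2 * k\<^sup>2 = m + 1"
    using assms(1) by (simp add: m_def)
  have "\<exists>v\<in>?V. m * (k + 2) + 2 \<le> c v"
  proof (rule label_growth)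
    show "card ?V = 2 * m + 2"
      using m assms(2) by (simp add: card_cartesian_product power2_eq_square)
    show "inj_on c ?V"
    proof (rule inj_onI, rule ccontr)
      fix u v assume uv: "u \<in> ?V" "v \<in> ?V" "c u = c v" "u \<noteq> v"
      \<comment> \<open>Equal labels would force a distance above the diameter.\<close>
      have "graph_dist ?T u v \<le> graph_diam ?T"
        using uv by (intro graph_dist_le_diam) auto
      with radio[of u v] uv show False by simp
    qed
    show "c u \<ge> 1" if "u \<in> ?V" for u
      using c that unfolding radio_labeling_def pverts_torus by blast
    show "c u + (k + 2) \<le> c w"
      if uvw: "{u, v, w} \<subseteq> ?V" and "u \<noteq> v" "v \<noteq> w" "u \<noteq> w" and le: "c u \<le> c v" "c v \<le> c w"
      for u v w
    proof -
      have "1 + int (graph_diam ?T) \<le> int (graph_dist ?T u v) + \<bar>int (c u) - int (c v)\<bar>"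
        "1 + int (graph_diam ?T) \<le> int (graph_dist ?T v w) + \<bar>int (c v) - int (c w)\<bar>"
        "1 + int (graph_diam ?T) \<le> int (graph_dist ?T u w) + \<bar>int (c u) - int (c w)\<bar>"
        using that radio[of u v] radio[of v w] radio[of u w] by simp_all
      \<comment> \<open>As the labels are sorted, the absolute differences sum to
        \<open>2 * (c w - c u)\<close>. This is at least \<open>2 * k + 3\<close>, and integrality
        rounds the half up to \<open>k + 2\<close>.\<close>
      with graph_dist_torus_perimeter[OF n uvw] graph_diam_torus_ge[OF assms] le assms(2)
      show ?thesis by linarith
    qed
  qed
  then obtain v where "v \<in> ?V" "m * (k + 2) + 2 \<le> c v" by blast
  moreover have "c v \<le> radio_number ?T" if "v \<in> ?V" for v
    unfolding span[symmetric] labeling_span_def using that by (intro Max_ge) auto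
  ultimately have "m * (k + 2) + 2 \<le> radio_number ?T"
    by (meson le_trans)
  then have "real m * (real k + 2) + 2 \<le> real (radio_number ?T)"
    by (metis of_nat_add of_nat_le_iff of_nat_mult of_nat_numeral)
  moreover have "((real n)\<^sup>2 - 2) / 2 = real m"
  proof -
    have "2 * (real k)\<^sup>2 = real m + 1"
      using m by (metis of_nat_1 of_nat_add of_nat_mult of_nat_numeral of_nat_power)
    then show ?thesis
      using assms(2) by (simp add: power_mult_distrib)
  qed
  ultimately show ?thesis by simp
qed

end
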